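(* Let $r$ be the row reading word of a standard tableau. If $w$ is a permutation which is related to $r$ by one proper $K_1$ move or one proper $K_2$ move, then $w$ has steady-state time $1$.
   Context: The row reading word of a tableau (English notation) is the concatenation of its rows from bottom to top, each read left to right. Knuth moves on $S_n$, with $x<y<z$: a $K_1$ move relates $\cdots yxz\cdots$ and $\cdots yzx\cdots$; a $K_2$ move relates $\cdots xzy\cdots$ and $\cdots zxy\cdots$ (same entries elsewhere). A $K_B$ move relates $\cdots y_1xzy_2\cdots$ and $\cdots y_1zxy_2\cdots$ with $x<y_1<z$ and $x<y_2<z$. A proper $K_1$ (resp. $K_2$) move is a $K_1$ (resp. $K_2$) move that is not a $K_B$ move. Box-ball system (BBS): boxes in a row extending infinitely to the right, each holding at most one ball, balls labeled $1,\dots,n$. A permutation $w=w_1\cdots w_n$ gives the time-$0$ configuration with ball $w_i$ in the $i$-th of $n$ consecutive boxes. A BBS move moves ball $1$ to the nearest empty box to its right, then ball $2$, ..., then ball $n$; the state at time $t$ is obtained after $t$ moves. An increasing run is a maximal block of balls in consecutive boxes with labels increasing left to right; a soliton is an increasing run preserved by all subsequent BBS moves (its balls stay consecutive and in order, and the runs keep their relative order). A configuration is in steady state if all its increasing runs are solitons. The steady-state time of $w$ is the least $t\ge0$ such that the state at time $t$ is in steady state. *)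

theory Defs
  imports "HOL-Combinatorics.Multiset_Permutations"
begin

(* Permutations of {1..n} are words in one-line notation,
   i.e. elements of permutations_of_set {1..n}. *)

section \<open>Standard tableaux and reading words\<close>

(* English notation: a tableau is the list of its rows from top to bottom. *)
definition standard_tableau :: "nat \<Rightarrow> nat list list \<Rightarrow> bool" where
  "standard_tableau n T \<longleftrightarrow>
     [] \<notin> set T \<and>
     sorted_wrt (\<lambda>R S. length R \<ge> length S) T \<and>
     concat T \<in> permutations_of_set {1..n} \<and>
     (\<forall>R\<in>set T. sorted_wrt (<) R) \<and>
     (\<forall>i j. Suc i < length T \<and> j < length (T ! Suc i) \<longrightarrow> T ! i ! j < T ! Suc i ! j)"

definition row_reading_word :: "'a list list \<Rightarrow> 'a list" where
  "row_reading_word T = concat (rev T)"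

section \<open>Knuth moves\<close>

definition K1_move :: "nat list \<Rightarrow> nat list \<Rightarrow> bool" where
  "K1_move u v \<longleftrightarrow> (\<exists>p s x y z. x < y \<and> y < z \<and>
     (u = p @ [y, x, z] @ s \<and> v = p @ [y, z, x] @ s \<or>
      u = p @ [y, z, x] @ s \<and> v = p @ [y, x, z] @ s))"

definition K2_move :: "nat list \<Rightarrow> nat list \<Rightarrow> bool" where
  "K2_move u v \<longleftrightarrow> (\<exists>p s x y z. x < y \<and> y < z \<and>
     (u = p @ [x, z, y] @ s \<and> v = p @ [z, x, y] @ s \<or>
      u = p @ [z, x, y] @ s \<and> v = p @ [x, z, y] @ s))"

definition KB_move :: "nat list \<Rightarrow> nat list \<Rightarrow> bool" where
  "KB_move u v \<longleftrightarrow> (\<exists>p s x y\<^sub>1 y\<^sub>2 z. x < y\<^sub>1 \<and> y\<^sub>1 < z \<and> x < y\<^sub>2 \<and> y\<^sub>2 < z \<and>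
     (u = p @ [y\<^sub>1, x, z, y\<^sub>2] @ s \<and> v = p @ [y\<^sub>1, z, x, y\<^sub>2] @ s \<or>
      u = p @ [y\<^sub>1, z, x, y\<^sub>2] @ s \<and> v = p @ [y\<^sub>1, x, z, y\<^sub>2] @ s))"

definition proper_K1_move :: "nat list \<Rightarrow> nat list \<Rightarrow> bool" where
  "proper_K1_move u v \<longleftrightarrow> K1_move u v \<and> \<not> KB_move u v"

definition proper_K2_move :: "nat list \<Rightarrow> nat list \<Rightarrow> bool" where
  "proper_K2_move u v \<longleftrightarrow> K2_move u v \<and> \<not> KB_move u v"

section \<open>The box-ball system\<close>

(* Boxes are numbered 0, 1, 2, ... from left to right; a configuration maps
   a box to the label of its ball, or to None if the box is empty. *)
type_synonym bbs_config = "nat \<rightharpoonup> nat"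

(* Only used when ball k lies in exactly one box and some box to its right is empty;
   both hold in every state reached from a permutation. *)
definition move_ball :: "nat \<Rightarrow> bbs_config \<Rightarrow> bbs_config" where
  "move_ball k c =
     (let p = (THE p. c p = Some k);
          q = (LEAST q. q > p \<and> c q = None)
      in c(p := None, q := Some k))"

(* Balls are moved in the order 1, 2, ..., n. *)
definition bbs_move :: "nat \<Rightarrow> bbs_config \<Rightarrow> bbs_config" where
  "bbs_move n = fold move_ball [1..<Suc n]"

definition initial_config :: "nat list \<Rightarrow> bbs_config" where
  "initial_config w = (\<lambda>i. if i < length w then Some (w ! i) else None)"

definition bbs_state :: "nat list \<Rightarrow> nat \<Rightarrow> bbs_config" where
  "bbs_state w t = (bbs_move (length w) ^^ t) (initial_config w)"

(* Balls with increasing labels L in the consecutive boxes a, ..., a + length L - 1. *)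
definition increasing_block :: "bbs_config \<Rightarrow> nat \<Rightarrow> nat list \<Rightarrow> bool" where
  "increasing_block c a L \<longleftrightarrow>
     L \<noteq> [] \<and> sorted_wrt (<) L \<and> (\<forall>i<length L. c (a + i) = Some (L ! i))"

definition increasing_run :: "bbs_config \<Rightarrow> nat \<Rightarrow> nat list \<Rightarrow> bool" where
  "increasing_run c a L \<longleftrightarrow> increasing_block c a L \<and>
     (\<forall>b M. increasing_block c b M \<and> {a..<a + length L} \<subseteq> {b..<b + length M} \<longrightarrow>
        b = a \<and> M = L)"

(* The last conjunct says that the run keeps its position relative to
   every other run that is present both in c and t moves later. *)
definition soliton :: "nat \<Rightarrow> bbs_config \<Rightarrow> nat \<Rightarrow> nat list \<Rightarrow> bool" where
  "soliton n c a L \<longleftrightarrow> increasing_run c a L \<and>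
     (\<forall>t. \<exists>a'. increasing_run ((bbs_move n ^^ t) c) a' L \<and>
        (\<forall>b M b'. increasing_run c b M \<and> increasing_run ((bbs_move n ^^ t) c) b' M \<longrightarrow>
           (b < a \<longleftrightarrow> b' < a')))"

definition steady_state :: "nat \<Rightarrow> bbs_config \<Rightarrow> bool" where
  "steady_state n c \<longleftrightarrow> (\<forall>a L. increasing_run c a L \<longrightarrow> soliton n c a L)"

(* A relation rather than a LEAST term, so that it includes the existence of such a time. *)
definition has_steady_state_time :: "nat list \<Rightarrow> nat \<Rightarrow> bool" where
  "has_steady_state_time w t \<longleftrightarrow>
     steady_state (length w) (bbs_state w t) \<and>
     (\<forall>s<t. \<not> steady_state (length w) (bbs_state w s))"

end

theory Submission
  imports Defs
begin

text \<open>The descents of a row reading word are exactly the row ends, and together with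
  column-strictness this leaves only two kinds of proper moves: there is a one-box row \<open>s\<close>
  (so all rows below it have one box, too), directly above it a row \<open>x, z, \<dots>\<close>, and the
  letters \<open>s x z\<close> become \<open>s z x\<close> (if \<open>x < s < z\<close>) or \<open>x s z\<close> (if \<open>x < z < s\<close>).
  In both cases one BBS move turns \<open>w\<close> into a state whose runs are the rows of the tableau:
  every row has advanced by its length from its place in the reading word, except that
  \<open>s\<close> has advanced by one more box. A family of rows in which each row forms a skew tableau
  with the next one moves on in this way forever. The state at time 0 is not steady because
  its run \<open>s z\<close> (or \<open>x s\<close>) is torn apart by the first move.\<close>

section \<open>Positions of balls\<close>

definition has_positions :: "nat \<Rightarrow> bbs_config \<Rightarrow> (nat \<Rightarrow> nat) \<Rightarrow> bool" where
  "has_positions n c P \<longleftrightarrow> (\<forall>p v. c p = Some v \<longleftrightarrow> v \<in> {1..n} \<and> P v = p)"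

lemma has_positions_SomeD:
  "has_positions n c P \<Longrightarrow> c p = Some v \<Longrightarrow> v \<in> {1..n} \<and> P v = p"
  by (simp add: has_positions_def)

lemma has_positions_at: "has_positions n c P \<Longrightarrow> v \<in> {1..n} \<Longrightarrow> c (P v) = Some v"
  by (simp add: has_positions_def)

text \<open>When ball \<open>v\<close> moves, the smaller balls are already at their new positions \<open>Q\<close> and the
  larger ones still at their old positions \<open>P\<close>; so the last two conditions say that \<open>Q v\<close> is
  the first empty box to the right of \<open>P v\<close>.\<close>

definition bbs_step :: "nat \<Rightarrow> (nat \<Rightarrow> nat) \<Rightarrow> (nat \<Rightarrow> nat) \<Rightarrow> bool" where
  "bbs_step n P Q \<longleftrightarrow> inj_on Q {1..n} \<and>
     (\<forall>v\<in>{1..n}. P v < Q v \<and>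
        (\<forall>u\<in>{1..n}. v < u \<longrightarrow> P u \<noteq> Q v) \<and>
        (\<forall>p. P v < p \<and> p < Q v \<longrightarrow> (\<exists>u\<in>{1..n}. u < v \<and> Q u = p \<or> v < u \<and> P u = p)))"

text \<open>Invariant within one BBS move: the balls up to \<open>m\<close> are at \<open>Q\<close>,
  the others still at \<open>P\<close>. The conditions of \<open>bbs_step\<close> evaluate the
  \<open>THE\<close> and \<open>LEAST\<close> terms of \<open>move_ball\<close> to
  \<open>P (Suc m)\<close> and \<open>Q (Suc m)\<close>.\<close>

lemma has_positions_move_ball:
  assumes c: "has_positions n c (\<lambda>v. if v \<le> m then Q v else P v)"
    and step: "bbs_step n P Q" and m: "m < n"
  shows "has_positions n (move_ball (Suc m) c) (\<lambda>v. if v \<le> Suc m then Q v else P v)"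
proof -
  have mem: "Suc m \<in> {1..n}" using m by simp
  have inj: "inj_on Q {1..n}" and lt: "P (Suc m) < Q (Suc m)"
    and emp: "\<And>u. u \<in> {1..n} \<Longrightarrow> Suc m < u \<Longrightarrow> P u \<noteq> Q (Suc m)"
    and fill: "\<And>p. P (Suc m) < p \<Longrightarrow> p < Q (Suc m) \<Longrightarrow>
       \<exists>u\<in>{1..n}. u < Suc m \<and> Q u = p \<or> Suc m < u \<and> P u = p"
    using step mem unfolding bbs_step_def by blast+
  have some: "c p = Some v \<longleftrightarrow> v \<in> {1..n} \<and> (if v \<le> m then Q v else P v) = p" for p v
    using c by (simp add: has_positions_def)
  have pos: "(THE p. c p = Some (Suc m)) = P (Suc m)"
    using mem by (intro the_equality) (auto simp: some)
  have Qne: "Q v \<noteq> Q (Suc m)" if "v \<in> {1..n}" "v \<noteq> Suc m" for v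
    using inj that mem by (meson inj_onD)
  have free: "c (Q (Suc m)) = None"
  proof (rule ccontr)
    assume "c (Q (Suc m)) \<noteq> None"
    then obtain v where "c (Q (Suc m)) = Some v" by auto
    then have v: "v \<in> {1..n}" "(if v \<le> m then Q v else P v) = Q (Suc m)" by (simp_all add: some)
    consider "v \<le> m" | "v = Suc m" | "Suc m < v" by linarith
    then show False
      by cases (use v Qne[of v] emp[of v] lt in auto)
  qed
  have occ: "c p \<noteq> None" if p: "P (Suc m) < p" "p < Q (Suc m)" for p
  proof -
    obtain u where "u \<in> {1..n}" "u < Suc m \<and> Q u = p \<or> Suc m < u \<and> P u = p"
      using fill[OF p] by blast
    then have "c p = Some u" by (auto simp: some)
    then show ?thesis by simp
  qed
  have least: "(LEAST q. q > P (Suc m) \<and> c q = None) = Q (Suc m)"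
  proof (rule Least_equality)
    show "P (Suc m) < Q (Suc m) \<and> c (Q (Suc m)) = None" using lt free by simp
    show "Q (Suc m) \<le> y" if "P (Suc m) < y \<and> c y = None" for y
      using that occ[of y] by (meson linorder_not_le)
  qed
  have "move_ball (Suc m) c = c(P (Suc m) := None, Q (Suc m) := Some (Suc m))"
    unfolding move_ball_def Let_def pos least ..
  moreover have "(c(P (Suc m) := None, Q (Suc m) := Some (Suc m))) p = Some v \<longleftrightarrow>
      v \<in> {1..n} \<and> (if v \<le> Suc m then Q v else P v) = p" for p v
  proof -
    have at: "c (P (Suc m)) = Some (Suc m)" using mem by (simp add: some)
    consider "v \<le> m" | "v = Suc m" | "Suc m < v" by linarith
    then show ?thesis
    proof cases
      case 1
      then show ?thesis using Qne[of v] at some[of p v] by auto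
    next
      case 2
      then show ?thesis using mem lt some[of p v] by auto
    next
      case 3
      then show ?thesis using emp[of v] at some[of p v] by auto
    qed
  qed
  ultimately show ?thesis by (simp add: has_positions_def)
qed

lemma has_positions_bbs_move:
  assumes "has_positions n c P" "bbs_step n P Q"
  shows "has_positions n (bbs_move n c) Q"
proof -
  have "has_positions n (fold move_ball [1..<Suc m] c) (\<lambda>v. if v \<le> m then Q v else P v)"
    if "m \<le> n" for m
    using that
  proof (induction m)
    case 0
    then show ?case using assms(1) by (auto simp: has_positions_def)
  next
    case (Suc m)
    then show ?case
      using has_positions_move_ball[OF _ assms(2), of "fold move_ball [1..<Suc m] c" m] by simp
  qed
  from this[of n] show ?thesis
    by (auto simp: bbs_move_def has_positions_def)
qed

section \<open>Rows moving as solitons\<close>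

text \<open>Rows are listed from left to right along the boxes, for a tableau from bottom to top, so
  lengths grow and the faster rows are in front. In place of the column condition there is
  \<open>separated\<close> below, which follows the rows as they drift apart.\<close>

locale ball_rows =
  fixes n :: nat and L :: "nat list list"
  assumes row_nonempty: "j < length L \<Longrightarrow> L ! j \<noteq> []"
    and row_sorted: "j < length L \<Longrightarrow> sorted_wrt (<) (L ! j)"
    and row_length_mono: "Suc j < length L \<Longrightarrow> length (L ! j) \<le> length (L ! Suc j)"
    and rows_distinct: "distinct (concat L)"
    and rows_balls: "set (concat L) = {1..n}"
begin

lemma cell_eqD:
  assumes "j < length L" "i < length (L ! j)" "j' < length L" "i' < length (L ! j')"
    and "L ! j ! i = L ! j' ! i'"
  shows "j = j' \<and> i = i'"
proof -
  \<comment> \<open>Distinctness of a concatenation does not prevent repeated empty rows, so these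
    are excluded first.\<close>
  have "[] \<notin> set L" using row_nonempty by (metis in_set_conv_nth)
  then have d: "distinct L" "\<forall>ys\<in>set L. distinct ys"
    "\<forall>ys zs. ys \<in> set L \<and> zs \<in> set L \<and> ys \<noteq> zs \<longrightarrow> set ys \<inter> set zs = {}"
    using rows_distinct by (auto simp: distinct_concat_iff)
  have "L ! j = L ! j'"
    using d(3) assms by (metis disjoint_iff nth_mem)
  then have "j = j'" using d(1) assms by (simp add: nth_eq_iff_index_eq)
  then show ?thesis using d(2) assms by (simp add: nth_eq_iff_index_eq)
qed

lemma cell_ball: "j < length L \<Longrightarrow> i < length (L ! j) \<Longrightarrow> L ! j ! i \<in> {1..n}"
  unfolding rows_balls[symmetric] set_concat by (meson UN_I nth_mem)

lemma ball_cellE: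
  assumes "v \<in> {1..n}"
  obtains j i where "j < length L" "i < length (L ! j)" "v = L ! j ! i"
  using assms unfolding rows_balls[symmetric] by (auto simp: in_set_conv_nth)

lemma row_less: "j < length L \<Longrightarrow> i < i' \<Longrightarrow> i' < length (L ! j) \<Longrightarrow> L ! j ! i < L ! j ! i'"
  using row_sorted sorted_wrt_nth_less by blast

lemma row_le: "j < length L \<Longrightarrow> i \<le> i' \<Longrightarrow> i' < length (L ! j) \<Longrightarrow> L ! j ! i \<le> L ! j ! i'"
  using row_less[of j i i'] by (cases "i = i'") auto

lemma row_length_mono': "j \<le> j' \<Longrightarrow> j' < length L \<Longrightarrow> length (L ! j) \<le> length (L ! j')"
  by (induction j' rule: dec_induct) (auto intro: le_trans row_length_mono)

definition pos :: "(nat \<Rightarrow> nat) \<Rightarrow> nat \<Rightarrow> nat" where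
  "pos a v = (THE p. \<exists>j<length L. \<exists>i<length (L ! j). v = L ! j ! i \<and> p = a j + i)"

lemma pos_cell:
  assumes "j < length L" "i < length (L ! j)"
  shows "pos a (L ! j ! i) = a j + i"
  unfolding pos_def using assms by (intro the_equality) (auto dest: cell_eqD)

text \<open>The last condition makes row \<open>j\<close> and row \<open>j + 1\<close> a skew tableau when row \<open>j\<close> is shifted
  by its length.\<close>

definition separated :: "(nat \<Rightarrow> nat) \<Rightarrow> bool" where
  "separated a \<longleftrightarrow> (\<forall>j. Suc j < length L \<longrightarrow>
     a j + length (L ! j) \<le> a (Suc j) \<and>
     (\<forall>i<length (L ! j). \<forall>i'<length (L ! Suc j).
        a j + length (L ! j) + i = a (Suc j) + i' \<longrightarrow> L ! Suc j ! i' < L ! j ! i))"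

lemma separated_end_le:
  assumes "separated a" "j < j'" "j' < length L"
  shows "a j + length (L ! j) \<le> a j'"
  using assms(2,3)
proof (induction j' rule: less_induct)
  case (less j')
  then obtain k where k: "j' = Suc k" "j \<le> k" by (cases j') auto
  have "a k + length (L ! k) \<le> a (Suc k)"
    using assms(1) less.prems k by (auto simp: separated_def)
  then show ?case using less k by (cases "j = k") force+
qed

lemma separated_start_less:
  "separated a \<Longrightarrow> j < j' \<Longrightarrow> j' < length L \<Longrightarrow> a j < a j'"
  using separated_end_le[of a j j'] row_nonempty[of j] by (cases "L ! j") auto

lemma separated_cell_eqD:
  assumes "separated a" "j < length L" "i < length (L ! j)" "j' < length L" "i' < length (L ! j')"
    and "a j + i = a j' + i'"
  shows "j = j' \<and> i = i'"
proof (cases j j' rule: linorder_cases)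
  case less
  then show ?thesis using separated_end_le[OF assms(1), of j j'] assms by auto
next
  case equal
  then show ?thesis using assms by auto
next
  case greater
  then show ?thesis using separated_end_le[OF assms(1), of j' j] assms by auto
qed

lemma separated_inj: "separated a \<Longrightarrow> inj_on (pos a) {1..n}"
  by (rule inj_onI, elim ball_cellE) (auto simp: pos_cell dest: separated_cell_eqD)

definition advance :: "(nat \<Rightarrow> nat) \<Rightarrow> nat \<Rightarrow> nat" where
  "advance a j = a j + length (L ! j)"

text \<open>Shifted by its own length, row \<open>j\<close> occupies the boxes directly after its
  old place. Row \<open>Suc j\<close> begins no earlier than that and is at least as long, so the
  shifted row cannot reach beyond it.\<close>

lemma separated_target:
  assumes a: "separated a" and cells: "j < length L" "i < length (L ! j)" "j' < length L" "i' < length (L ! j')"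
    and eq: "a j + length (L ! j) + i = a j' + i'"
  shows "j' = Suc j \<and> L ! Suc j ! i' < L ! j ! i"
proof -
  have "\<not> j' < j" using separated_end_le[OF a, of j' j] cells eq by auto
  moreover have "j' \<noteq> j" using cells eq by auto
  moreover have "\<not> Suc j < j'"
  proof
    assume "Suc j < j'"
    then show False
      using separated_end_le[OF a, of j "Suc j"] separated_end_le[OF a, of "Suc j" j']
        row_length_mono[of j] cells eq by auto
  qed
  ultimately have "j' = Suc j" by simp
  then show ?thesis using a cells eq by (auto simp: separated_def)
qed

text \<open>Row \<open>Suc j\<close> moves at least as far as row \<open>j\<close>. Relative to row
  \<open>j\<close> it slides to the right, so its entries face the same or larger entries of the
  increasing row \<open>j\<close>.\<close>

lemma separated_advance:
  assumes a: "separated a"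
  shows "separated (advance a)"
  unfolding separated_def
proof (intro allI impI conjI)
  fix j assume j: "Suc j < length L"
  have gap: "a j + length (L ! j) \<le> a (Suc j)" using a j by (auto simp: separated_def)
  have len: "length (L ! j) \<le> length (L ! Suc j)" using j by (rule row_length_mono)
  show "advance a j + length (L ! j) \<le> advance a (Suc j)"
    using gap len by (simp add: advance_def)
  fix i i' assume i: "i < length (L ! j)" "i' < length (L ! Suc j)"
    "advance a j + length (L ! j) + i = advance a (Suc j) + i'"
  \<comment> \<open>\<open>i0\<close> is the index in row \<open>j\<close> that cell
    \<open>i'\<close> faced before the advance; the subtraction is exact by
    \<open>gap\<close>.\<close>
  define i0 where "i0 = a (Suc j) + i' - (a j + length (L ! j))"
  have i0: "a j + length (L ! j) + i0 = a (Suc j) + i'" "i0 \<le> i"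
    using gap i len by (auto simp: i0_def advance_def)
  then have "L ! Suc j ! i' < L ! j ! i0"
    using a j i by (auto simp: separated_def)
  also have "\<dots> \<le> L ! j ! i" using i0 i j by (intro row_le) auto
  finally show "L ! Suc j ! i' < L ! j ! i" .
qed

text \<open>A ball passes first over the larger balls of its row, which have not moved yet, and then
  over the smaller ones, which have. By \<open>separated_target\<close>, a ball whose old place is
  the target box is smaller and has already left.\<close>

lemma bbs_step_advance:
  assumes a: "separated a"
  shows "bbs_step n (pos a) (pos (advance a))"
  unfolding bbs_step_def
proof (intro conjI ballI allI impI)
  show "inj_on (pos (advance a)) {1..n}"
    using a by (intro separated_inj separated_advance)
next
  fix v assume "v \<in> {1..n}"
  then obtain j i where v: "j < length L" "i < length (L ! j)" "v = L ! j ! i" by (rule ball_cellE)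
  show "pos a v < pos (advance a) v"
    using v by (auto simp: pos_cell advance_def)
  fix u assume "u \<in> {1..n}" and "v < u"
  then obtain j' i' where u: "j' < length L" "i' < length (L ! j')" "u = L ! j' ! i'"
    by (elim ball_cellE)
  show "pos a u \<noteq> pos (advance a) v"
    using separated_target[OF a v(1,2) u(1,2)] u v \<open>v < u\<close> by (auto simp: pos_cell advance_def)
next
  fix v p assume "v \<in> {1..n}" and p: "pos a v < p \<and> p < pos (advance a) v"
  then obtain j i where v: "j < length L" "i < length (L ! j)" "v = L ! j ! i" by (elim ball_cellE)
  have p': "a j + i < p" "p < a j + length (L ! j) + i"
    using p v by (auto simp: pos_cell advance_def)
  show "\<exists>u\<in>{1..n}. u < v \<and> pos (advance a) u = p \<or> v < u \<and> pos a u = p"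
  proof (cases "p < a j + length (L ! j)")
    case True
    then have "L ! j ! (p - a j) \<in> {1..n}" "v < L ! j ! (p - a j)" "pos a (L ! j ! (p - a j)) = p"
      using v p' cell_ball[of j "p - a j"] by (auto simp: pos_cell intro!: row_less)
    then show ?thesis by blast
  next
    case False
    define i' where "i' = p - a j - length (L ! j)"
    have i': "i' < i" "p = a j + length (L ! j) + i'" using False p' by (auto simp: i'_def)
    then have "L ! j ! i' \<in> {1..n}" "L ! j ! i' < v" "pos (advance a) (L ! j ! i') = p"
      using v cell_ball[of j i'] by (auto simp: pos_cell advance_def intro!: row_less)
    then show ?thesis by blast
  qed
qed

section \<open>Increasing runs and solitons of separated rows\<close>

lemma config_cell:
  "has_positions n c (pos a) \<Longrightarrow> j < length L \<Longrightarrow> i < length (L ! j) \<Longrightarrow> c (a j + i) = Some (L ! j ! i)"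
  by (metis cell_ball has_positions_at pos_cell)

lemma config_SomeE:
  assumes "has_positions n c (pos a)" "c p = Some v"
  obtains j i where "j < length L" "i < length (L ! j)" "v = L ! j ! i" "p = a j + i"
  using has_positions_SomeD[OF assms] by (metis ball_cellE pos_cell)

lemma increasing_block_row:
  "has_positions n c (pos a) \<Longrightarrow> j < length L \<Longrightarrow> increasing_block c (a j) (L ! j)"
  by (simp add: increasing_block_def row_nonempty row_sorted config_cell)

text \<open>Labels drop at the end of a row: a ball in the box after it belongs to the next row and
  is smaller than every ball of the row just ended. Induction along the block keeps it inside the
  row of its first ball.\<close>

lemma increasing_block_in_row:
  assumes a: "separated a" and c: "has_positions n c (pos a)" and M: "increasing_block c b M"
  obtains j where "j < length L" "a j \<le> b" "b + length M \<le> a j + length (L ! j)"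
proof -
  have M': "M \<noteq> []" "sorted_wrt (<) M" "\<And>i. i < length M \<Longrightarrow> c (b + i) = Some (M ! i)"
    using M by (auto simp: increasing_block_def)
  have "c b = Some (M ! 0)" using M'(1) M'(3)[of 0] by simp
  then obtain j i where j: "j < length L" "i < length (L ! j)" "b = a j + i"
    using config_SomeE[OF c] by metis
  have "b + t < a j + length (L ! j)" if "t < length M" for t
    using that
  proof (induction t)
    case 0
    then show ?case using j by simp
  next
    case (Suc t)
    then have t: "b + t < a j + length (L ! j)" by simp
    show ?case
    proof (rule ccontr)
      assume "\<not> b + Suc t < a j + length (L ! j)"
      then have e: "i + t < length (L ! j)" "b + Suc t = a j + length (L ! j)" using t j by auto
      obtain j' i' where j': "j' < length L" "i' < length (L ! j')" "M ! Suc t = L ! j' ! i'"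
        "b + Suc t = a j' + i'"
        using config_SomeE[OF c M'(3)[OF Suc.prems]] by metis
      have "M ! t = L ! j ! (i + t)"
        using M'(3)[of t] config_cell[OF c j(1) e(1)] Suc.prems j by (simp add: add.assoc)
      moreover have "M ! Suc t < L ! j ! 0"
      proof -
        have "0 < length (L ! j)" "a j + length (L ! j) + 0 = a j' + i'" using j e j' by auto
        then show ?thesis using separated_target[OF a j(1) _ j'(1,2), of 0] j'(3) by simp
      qed
      moreover have "L ! j ! 0 \<le> L ! j ! (i + t)" using j e by (intro row_le) auto
      moreover have "M ! t < M ! Suc t"
        using M'(2) Suc.prems by (intro sorted_wrt_nth_less) auto
      ultimately show False by simp
    qed
  qed
  from this[of "length M - 1"] M'(1) have "b + length M \<le> a j + length (L ! j)"
    by (cases M) auto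
  with j show ?thesis by (intro that) auto
qed

lemma increasing_run_iff:
  assumes a: "separated a" and c: "has_positions n c (pos a)"
  shows "increasing_run c b M \<longleftrightarrow> (\<exists>j<length L. b = a j \<and> M = L ! j)"
proof
  assume run: "increasing_run c b M"
  then obtain j where j: "j < length L" "a j \<le> b" "b + length M \<le> a j + length (L ! j)"
    using increasing_block_in_row[OF a c] by (metis increasing_run_def)
  then have "{b..<b + length M} \<subseteq> {a j..<a j + length (L ! j)}" by auto
  then show "\<exists>j<length L. b = a j \<and> M = L ! j"
    using run increasing_block_row[OF c j(1)] j(1) unfolding increasing_run_def by metis
next
  assume "\<exists>j<length L. b = a j \<and> M = L ! j"
  then obtain j where j: "j < length L" "b = a j" "M = L ! j" by blast
  have "b' = b \<and> M' = M"
    if M': "increasing_block c b' M'" and sub: "{b..<b + length M} \<subseteq> {b'..<b' + length M'}" for b' M'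
  proof -
    obtain j' where j': "j' < length L" "a j' \<le> b'" "b' + length M' \<le> a j' + length (L ! j')"
      using increasing_block_in_row[OF a c M'] .
    have ne: "M \<noteq> []" using j row_nonempty by simp
    then have le: "b' \<le> b" "b + length M \<le> b' + length M'" using sub by auto
    \<comment> \<open>Box \<open>a j\<close> lies in row \<open>j\<close> and, by the inclusion, in
      row \<open>j'\<close>; the difference is its index in row \<open>j'\<close>.\<close>
    have "a j + 0 = a j' + (a j - a j')" "a j - a j' < length (L ! j')" "0 < length (L ! j)"
      using le j j' ne by (auto simp flip: length_greater_0_conv)
    then have "j = j'" using separated_cell_eqD[OF a j(1) _ j'(1)] by blast
    then have "b' = b" and len: "length M' = length M" using le j j' by auto
    moreover have "M' = M"
    proof (rule nth_equalityI[OF len])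
      fix i assume "i < length M'"
      then show "M' ! i = M ! i"
        using M' \<open>b' = b\<close> len config_cell[OF c j(1), of i] j by (auto simp: increasing_block_def)
    qed
    ultimately show ?thesis by simp
  qed
  then show "increasing_run c b M"
    unfolding increasing_run_def using increasing_block_row[OF c j(1)] j by auto
qed

lemma bbs_moves_separated:
  assumes "separated a" "has_positions n c (pos a)"
  obtains a' where "separated a'" "has_positions n ((bbs_move n ^^ t) c) (pos a')"
proof -
  have "separated ((advance ^^ t) a) \<and> has_positions n ((bbs_move n ^^ t) c) (pos ((advance ^^ t) a))"
    by (induction t)
      (use assms in \<open>auto intro: separated_advance has_positions_bbs_move bbs_step_advance\<close>)
  then show ?thesis using that by blast
qed

text \<open>Separation survives every move, so at all times the runs are the same rows, ordered by
  index.\<close>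

theorem steady_state_separated:
  assumes a: "separated a" and c: "has_positions n c (pos a)"
  shows "steady_state n c"
  unfolding steady_state_def
proof (intro allI impI)
  fix b M assume run: "increasing_run c b M"
  then obtain j where j: "j < length L" "b = a j" "M = L ! j"
    using increasing_run_iff[OF a c] by blast
  \<comment> \<open>Runs at different times are matched by their labels, so the labels must
    determine the row index.\<close>
  have rows_inj: "i = i'" if "i < length L" "i' < length L" "L ! i = L ! i'" for i i'
    using that cell_eqD[of i 0 i' 0] row_nonempty by auto
  show "soliton n c b M"
    unfolding soliton_def
  proof (intro conjI run allI)
    fix t
    obtain a' where a': "separated a'" and c': "has_positions n ((bbs_move n ^^ t) c) (pos a')"
      using bbs_moves_separated[OF a c] .
    have order: "a i < a j \<longleftrightarrow> a' i < a' j" if "i < length L" for i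
      using that j separated_start_less[OF a, of i j] separated_start_less[OF a, of j i]
        separated_start_less[OF a', of i j] separated_start_less[OF a', of j i]
      by (cases i j rule: linorder_cases) auto
    show "\<exists>b'. increasing_run ((bbs_move n ^^ t) c) b' M \<and>
        (\<forall>d N d'. increasing_run c d N \<and> increasing_run ((bbs_move n ^^ t) c) d' N \<longrightarrow>
           (d < b \<longleftrightarrow> d' < b'))"
      unfolding increasing_run_iff[OF a c] increasing_run_iff[OF a' c']
      by (rule exI[of _ "a' j"]) (use j order rows_inj in blast)
  qed
qed

end

section \<open>Row reading words and their Knuth neighbours\<close>

locale reading_rows = ball_rows +
  assumes column: "Suc j < length L \<Longrightarrow> i < length (L ! j) \<Longrightarrow> L ! Suc j ! i < L ! j ! i"
begin

definition start :: "nat \<Rightarrow> nat" where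
  "start j = length (concat (take j L))"

lemma start_Suc: "j < length L \<Longrightarrow> start (Suc j) = start j + length (L ! j)"
  by (simp add: start_def take_Suc_conv_app_nth)

lemma start_length: "start (length L) = length (concat L)"
  by (simp add: start_def)

lemma start_mono: "j \<le> j' \<Longrightarrow> start j \<le> start j'"
  by (metis concat_append le_add1 le_add_diff_inverse length_append start_def take_add)

lemma nth_start:
  assumes "j < length L" "i < length (L ! j)"
  shows "concat L ! (start j + i) = L ! j ! i"
proof -
  have "concat L = concat (take j L) @ L ! j @ concat (drop (Suc j) L)"
    by (subst id_take_nth_drop[OF assms(1)]) simp
  then show ?thesis using assms by (simp add: start_def nth_append)
qed

lemma start_less_length: "j < length L \<Longrightarrow> i < length (L ! j) \<Longrightarrow> start j + i < length (concat L)"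
  using start_mono[of "Suc j" "length L"] by (simp add: start_Suc start_length)

lemma index_cellE:
  assumes "k < length (concat L)"
  obtains j i where "j < length L" "i < length (L ! j)" "k = start j + i"
proof -
  have "\<exists>j<m. k < start j + length (L ! j) \<and> start j \<le> k" if "k < start m" "m \<le> length L" for m
    using that
  proof (induction m)
    case (Suc m)
    then show ?case by (cases "k < start m") (auto simp: start_Suc less_Suc_eq)
  qed (simp add: start_def)
  from this[of "length L"] assms obtain j where "j < length L" "k < start j + length (L ! j)" "start j \<le> k"
    by (auto simp: start_length)
  then show ?thesis using that[of j "k - start j"] by auto
qed

text \<open>In the reading word the rows adjoin. Shifting row \<open>j\<close> by its length
  left-aligns it with row \<open>Suc j\<close>, as in the tableau, so the condition becomes the
  column condition.\<close>

lemma separated_start: "separated start"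
  by (auto simp: separated_def start_Suc column)

lemma has_positions_start: "has_positions n (initial_config (concat L)) (pos start)"
  unfolding has_positions_def
proof (intro allI iffI)
  fix p v assume "initial_config (concat L) p = Some v"
  then have "p < length (concat L)" "concat L ! p = v"
    by (auto simp: initial_config_def split: if_splits)
  then show "v \<in> {1..n} \<and> pos start v = p"
    by (metis cell_ball index_cellE nth_start pos_cell)
next
  fix p v assume "v \<in> {1..n} \<and> pos start v = p"
  then show "initial_config (concat L) p = Some v"
    by (metis ball_cellE initial_config_def nth_start pos_cell start_less_length)
qed

text \<open>The word descends at every row boundary: by the column condition the next row begins
  with a smaller entry than the row just ended. So an ascent stays within one row.\<close>

lemma ascentE:
  assumes "Suc k < length (concat L)" "concat L ! k < concat L ! Suc k"
  obtains j i where "j < length L" "Suc i < length (L ! j)" "k = start j + i"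
proof -
  obtain j i where c: "j < length L" "i < length (L ! j)" "k = start j + i"
    using assms(1) index_cellE[of k] by auto
  have "Suc i < length (L ! j)"
  proof (rule ccontr)
    assume "\<not> Suc i < length (L ! j)"
    then have e: "Suc k = start (Suc j)" using c by (simp add: start_Suc)
    have j: "Suc j < length L"
      using c(1) assms(1) e start_length by (metis Suc_lessI less_irrefl)
    then have "0 < length (L ! Suc j)" using row_nonempty by simp
    then have "concat L ! Suc k = L ! Suc j ! 0" using nth_start[of "Suc j" 0] j e by simp
    also have "\<dots> < L ! j ! 0" using c j by (intro column) auto
    also have "\<dots> \<le> concat L ! k" using c by (auto simp: nth_start intro: row_le)
    finally show False using assms(2) by simp
  qed
  with c show ?thesis using that by blast
qed

lemma descentE:
  assumes "Suc k < length (concat L)" "concat L ! Suc k < concat L ! k"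
  obtains j where "Suc j < length L" "Suc k = start (Suc j)"
    "concat L ! k = L ! j ! (length (L ! j) - 1)" "concat L ! Suc k = L ! Suc j ! 0"
proof -
  obtain j i where c: "j < length L" "i < length (L ! j)" "k = start j + i"
    using assms(1) index_cellE[of k] by auto
  have "\<not> Suc i < length (L ! j)"
    using assms(2) nth_start[OF c(1), of "Suc i"] nth_start[OF c(1), of i] row_less[OF c(1), of i "Suc i"] c
    by auto
  then have i: "i = length (L ! j) - 1" and e: "Suc k = start (Suc j)" using c by (auto simp: start_Suc)
  have j: "Suc j < length L"
    using c(1) assms(1) e start_length by (metis Suc_lessI less_irrefl)
  then have "concat L ! Suc k = L ! Suc j ! 0"
    using nth_start[of "Suc j" 0] row_nonempty[of "Suc j"] e by simp
  then show ?thesis using that[OF j e] c i nth_start[of j i] by simp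
qed

end

section \<open>Exchanged letters and torn runs\<close>

lemma has_positions_swap:
  assumes "has_positions n c P" "u \<in> {1..n}" "v \<in> {1..n}" "P u = i" "P v = j" "i \<noteq> j"
  shows "has_positions n (c(i := Some v, j := Some u)) (P(v := i, u := j))"
proof -
  have "P w = P w' \<Longrightarrow> w = w'" if "w \<in> {1..n}" "w' \<in> {1..n}" for w w'
    using has_positions_at[OF assms(1)] that by (metis option.inject)
  then show ?thesis
    using assms unfolding has_positions_def by (auto split: if_splits)
qed

lemma initial_config_swap:
  "initial_config (p @ v # u # s) =
     (initial_config (p @ u # v # s))(length p := Some v, Suc (length p) := Some u)"
proof (rule ext)
  fix i
  consider "i < length p" | "i = length p" | "i = Suc (length p)"
    | k where "i = length p + Suc (Suc k)"
    by (metis Suc_lessI add_Suc_right less_imp_Suc_add linorder_neqE_nat)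
  then show "initial_config (p @ v # u # s) i =
      ((initial_config (p @ u # v # s))(length p := Some v, Suc (length p) := Some u)) i"
    by cases (simp_all add: initial_config_def nth_append)
qed

text \<open>A longer block would include a neighbouring box, where \<open>before\<close> or
  \<open>after\<close> contradicts the increase. The form \<open>p = Suc p'\<close> allows for box
  0, which has no left neighbour.\<close>

lemma increasing_run_pair:
  assumes "c p = Some u" "c (Suc p) = Some v" "u < v"
    and after: "\<And>t. c (Suc (Suc p)) = Some t \<Longrightarrow> t < v"
    and before: "\<And>p' t. p = Suc p' \<Longrightarrow> c p' = Some t \<Longrightarrow> u < t"
  shows "increasing_run c p [u, v]"
proof -
  have pair: "increasing_block c p [u, v]"
    using assms by (auto simp: increasing_block_def less_Suc_eq)
  moreover have "b = p \<and> M = [u, v]"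
    if M: "increasing_block c b M" and sub: "{p..<p + length [u, v]} \<subseteq> {b..<b + length M}" for b M
  proof -
    have at: "c (b + i) = Some (M ! i)" if "i < length M" for i
      using M that by (auto simp: increasing_block_def)
    have inc: "M ! i < M ! Suc i" if "Suc i < length M" for i
      using M that by (auto simp: increasing_block_def intro: sorted_wrt_nth_less)
    have le: "b \<le> p" "p + 2 \<le> b + length M" using sub by auto
    have "b = p"
    proof (rule ccontr)
      assume "b \<noteq> p"
      then obtain d where d: "p = b + Suc d" using le by (metis add_Suc_right le_neq_implies_less less_imp_Suc_add)
      then show False
        using at[of d] at[of "Suc d"] inc[of d] before[of "b + d" "M ! d"] le assms(1) by auto
    qed
    moreover have "length M = 2"
    proof (rule ccontr)
      assume "length M \<noteq> 2"
      then show False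
        using at[of 1] at[of 2] inc[of 1] after[of "M ! 2"] le assms(2) \<open>b = p\<close>
        by (auto simp: numeral_2_eq_2)
    qed
    moreover have "M = [u, v]"
      using \<open>length M = 2\<close> at[of 0] at[of 1] assms(1,2) \<open>b = p\<close>
      by (auto intro!: nth_equalityI simp: less_Suc_eq numeral_2_eq_2)
    ultimately show ?thesis by simp
  qed
  ultimately show ?thesis unfolding increasing_run_def by blast
qed

lemma torn_run_not_steady:
  assumes "increasing_run c p [u, v]" "has_positions n (bbs_move n c) Q" "Q v \<noteq> Suc (Q u)"
  shows "\<not> steady_state n c"
proof
  assume "steady_state n c"
  then obtain b where "increasing_run ((bbs_move n ^^ 1) c) b [u, v]"
    using assms(1) unfolding steady_state_def soliton_def by blast
  then have "increasing_block (bbs_move n c) b [u, v]"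
    by (simp add: increasing_run_def)
  then have "bbs_move n c b = Some u" "bbs_move n c (Suc b) = Some v"
    unfolding increasing_block_def by force+
  then show False using assms(2,3) by (auto simp: has_positions_def)
qed

section \<open>The first move from a Knuth neighbour\<close>

locale reading_corner = reading_rows +
  fixes q :: nat
  assumes corner: "Suc q < length L"
    and single: "length (L ! q) = 1"
    and double: "2 \<le> length (L ! Suc q)"
begin

text \<open>In the reading word, \<open>s x z\<close> are the consecutive letters in boxes
  \<open>q\<close>, \<open>q + 1\<close> and \<open>q + 2\<close>: the only box of row
  \<open>q\<close> and the first two boxes of the row above it.\<close>

definition s where "s = L ! q ! 0"
definition x where "x = L ! Suc q ! 0"
definition z where "z = L ! Suc q ! 1"

lemma corner_cells: "q < length L" "0 < length (L ! q)" "0 < length (L ! Suc q)" "1 < length (L ! Suc q)"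
  using corner single double by linarith+

lemma single': "j \<le> q \<Longrightarrow> length (L ! j) = 1"
  using row_length_mono'[of j q] row_nonempty[of j] corner single
  by (cases "L ! j") auto

lemma start_single: "j \<le> Suc q \<Longrightarrow> start j = j"
  by (induction j) (use corner in \<open>auto simp: start_Suc single' start_def[of 0]\<close>)

text \<open>Rows \<open>0\<close> to \<open>q\<close> have one box each, so they form the bottom of
  the first column, which decreases along \<open>L\<close>.\<close>

lemma above_corner: "j < q \<Longrightarrow> s < L ! j ! 0"
proof -
  have "k \<le> q \<Longrightarrow> j < k \<Longrightarrow> L ! k ! 0 < L ! j ! 0" for k
  proof (induction k)
    case (Suc k)
    then have "L ! Suc k ! 0 < L ! k ! 0"
      using corner single'[of k] by (intro column) auto
    with Suc show ?case by (cases "j = k") auto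
  qed simp
  then show "j < q \<Longrightarrow> s < L ! j ! 0" by (simp add: s_def)
qed

lemma corner_balls: "s \<in> {1..n}" "x \<in> {1..n}" "z \<in> {1..n}"
  unfolding s_def x_def z_def using cell_ball corner corner_cells by blast+

lemma corner_start: "pos start s = q" "pos start x = Suc q" "pos start z = Suc (Suc q)"
  unfolding s_def x_def z_def
  using pos_cell[OF corner_cells(1,2)] pos_cell[OF corner corner_cells(3)]
    pos_cell[OF corner corner_cells(4)] by (simp_all add: start_single)

lemma corner_less: "x < s" "x < z"
  unfolding s_def x_def z_def
  using column[OF corner corner_cells(2)] row_less[OF corner _ corner_cells(4)] by simp_all

text \<open>The extra box for row \<open>q\<close> arises in both cases because box
  \<open>q + 2\<close> has just been vacated by a ball smaller than \<open>s\<close>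
  (\<open>x\<close> if \<open>s < z\<close>, \<open>z\<close> if \<open>z < s\<close>) and is the
  first empty box for \<open>s\<close>.\<close>

definition delayed :: "nat \<Rightarrow> nat" where
  "delayed j = advance start j + of_bool (j = q)"

lemma separated_delayed: "separated delayed"
  unfolding separated_def
proof (intro allI impI)
  fix j assume j: "Suc j < length L"
  have sep: "separated (advance start)" by (intro separated_advance separated_start)
  consider "Suc j < q" | "Suc j = q" | "j = q" | "q < j" by linarith
  then show "delayed j + length (L ! j) \<le> delayed (Suc j) \<and>
      (\<forall>i<length (L ! j). \<forall>i'<length (L ! Suc j).
        delayed j + length (L ! j) + i = delayed (Suc j) + i' \<longrightarrow> L ! Suc j ! i' < L ! j ! i)"
  proof cases
    case 3
    \<comment> \<open>Row \<open>q\<close> shifted is box \<open>q + 3\<close>, and row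
      \<open>Suc q\<close> begins at box \<open>q + 1\<close> plus its length. They meet only if
      that length is 2, in the cell of \<open>x\<close>, and \<open>x < s\<close>.\<close>
    have first: "i' = 0" if "length (L ! Suc q) + i' = 2" for i' using that double by linarith
    with 3 show ?thesis
      using double single corner_less(1)
      by (auto simp: delayed_def advance_def start_single s_def x_def dest!: first)
  next
    case 2
    then show ?thesis
      using single'[of j] single'[of q] start_single[of j] start_single[of q]
      by (auto simp: delayed_def advance_def)
  qed (use sep j in \<open>auto simp: separated_def delayed_def\<close>)
qed

lemma pos_delayed:
  assumes "v \<in> {1..n}"
  shows "pos delayed v = (if v = s then Suc (Suc q) else pos (advance start) v)"
proof -
  obtain j i where c: "j < length L" "i < length (L ! j)" "v = L ! j ! i"
    using assms by (rule ball_cellE)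
  have "j = q \<longleftrightarrow> v = s" unfolding s_def using c cell_eqD[OF c(1,2) corner_cells(1,2)] single by auto
  then show ?thesis
    using c single by (auto simp: pos_cell delayed_def advance_def start_single)
qed

lemma pos_advance_s: "pos (advance start) s = Suc q"
  unfolding s_def
  using pos_cell[OF corner_cells(1,2)] by (simp add: advance_def start_single single)

text \<open>\<open>P\<close> differs from \<open>pos start\<close> only within boxes
  \<open>q\<close> to \<open>q + 2\<close>, and \<open>delayed\<close> changes only the target of
  \<open>s\<close>. Beyond box \<open>q + 2\<close> the conditions are inherited from the
  undisturbed step of the reading word.\<close>

lemma bbs_step_corner:
  assumes P: "s < z \<and> P = (pos start)(z := Suc q, x := Suc (Suc q)) \<or>
    z < s \<and> P = (pos start)(x := q, s := Suc q)"
  shows "bbs_step n P (pos delayed)"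
  unfolding bbs_step_def
proof (rule conjI[OF _ ballI])
  show "inj_on (pos delayed) {1..n}" by (rule separated_inj[OF separated_delayed])
next
  fix v assume v: "v \<in> {1..n}"
  have step: "bbs_step n (pos start) (pos (advance start))"
    by (rule bbs_step_advance[OF separated_start])
  have start_inj: "u = u'" if "u \<in> {1..n}" "u' \<in> {1..n}" "pos start u = pos start u'" for u u'
    using separated_inj[OF separated_start] that by (meson inj_onD)
  have P_corner: "s < z \<and> P s = q \<and> P z = Suc q \<and> P x = Suc (Suc q) \<or>
      z < s \<and> P x = q \<and> P s = Suc q \<and> P z = Suc (Suc q)"
    using P corner_start corner_less by auto
  have P_other: "P u = pos start u" if "u \<noteq> s" "u \<noteq> x" "u \<noteq> z" for u
    using P that by auto
  have start_other: "pos start u \<notin> {q, Suc q, Suc (Suc q)}"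
    if "u \<in> {1..n}" "u \<noteq> s" "u \<noteq> x" "u \<noteq> z" for u
    using that start_inj corner_balls corner_start by (metis insertE singletonD)
  have far: "P u = pos start u" if "Suc (Suc q) < P u \<or> Suc (Suc q) < pos start u" for u
    using that P_corner P_other[of u] corner_start
    by (cases "u = s"; cases "u = x"; cases "u = z") auto
  obtain j i where c: "j < length L" "i < length (L ! j)" "v = L ! j ! i" using v by (rule ball_cellE)
  let ?thesis = "P v < pos delayed v \<and> (\<forall>u\<in>{1..n}. v < u \<longrightarrow> P u \<noteq> pos delayed v) \<and>
    (\<forall>p. P v < p \<and> p < pos delayed v \<longrightarrow>
      (\<exists>u\<in>{1..n}. u < v \<and> pos delayed u = p \<or> v < u \<and> P u = p))"
  consider "j < q" | "j = q" | "q < j" by linarith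
  then show ?thesis
  proof cases
    case 1
    have i: "i = 0" using c single'[of j] 1 by simp
    have "s < v" using above_corner[OF 1] c i by simp
    have start_v: "pos start v = j" using c i 1 by (simp add: pos_cell start_single)
    have Pv: "P v = j"
      using P_other[of v] start_v corner_start 1 by force
    have Qv: "pos delayed v = Suc j"
      using c i 1 single'[of j] by (simp add: pos_cell delayed_def advance_def start_single)
    have "P u \<noteq> Suc j" if u: "u \<in> {1..n}" "v < u" for u
    proof
      assume "P u = Suc j"
      \<comment> \<open>Of \<open>s\<close>, \<open>x\<close>, \<open>z\<close> only
        \<open>s\<close> or \<open>x\<close> can stand in a box up to \<open>q\<close>, and both are
        smaller than \<open>v\<close>. So \<open>u\<close> stands where it does in the reading
        word.\<close>
      then have "pos start u = Suc j"
        using P_other[of u] P_corner u 1 \<open>s < v\<close> corner_less by force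
      moreover have "pos start (L ! Suc j ! 0) = Suc j"
        using 1 corner single'[of "Suc j"] by (simp add: pos_cell start_single)
      moreover have "L ! Suc j ! 0 \<in> {1..n}"
        using 1 corner single'[of "Suc j"] by (intro cell_ball) auto
      ultimately have "u = L ! Suc j ! 0" using start_inj u(1) by metis
      moreover have "L ! Suc j ! 0 < v" using c i 1 corner by (auto intro: column)
      ultimately show False using u(2) by simp
    qed
    then show ?thesis using Pv Qv by auto
  next
    case 2
    then have v: "v = s" using c single by (simp add: s_def)
    have "P u \<noteq> Suc (Suc q)" if "u \<in> {1..n}" "s < u" for u
      using P_corner P_other[of u] start_other[of u] that corner_less(1) by force
    \<comment> \<open>Such a box exists only if \<open>s < z\<close>; it is box
      \<open>q + 1\<close>, still held by \<open>z\<close>.\<close>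
    moreover have "\<exists>u\<in>{1..n}. s < u \<and> P u = p" if "P s < p" "p < Suc (Suc q)" for p
      using P_corner that corner_balls(3) by (intro bexI[of _ z]) auto
    moreover have "P s < Suc (Suc q)"
      using P_corner by auto
    ultimately show ?thesis using v pos_delayed[OF corner_balls(1)] by auto
  next
    case 3
    then have vs: "v \<noteq> s" using c cell_eqD[OF c(1,2) corner_cells(1,2)] by (auto simp: s_def)
    then have Qv: "pos delayed v = pos (advance start) v" using pos_delayed[OF v] by simp
    have "start (Suc q) \<le> start j" "length (L ! Suc q) \<le> length (L ! j)"
      using 3 c by (auto intro: start_mono row_length_mono')
    \<comment> \<open>Row \<open>j\<close> begins at box \<open>q + 1\<close> or later and has at
      least two boxes, so each of its balls ends beyond box \<open>q + 2\<close>.\<close>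
    then have geQ: "Suc (Suc q) < pos delayed v" and geP: "Suc q \<le> pos start v"
      using c double unfolding Qv by (simp_all add: pos_cell advance_def start_single)
    have other: "v = x \<or> v = z \<or> Suc (Suc q) < pos start v"
      using geP start_other[OF v vs] by force
    have Pv: "P v < pos delayed v"
    proof -
      have "pos start v < pos delayed v" using step v Qv by (auto simp: bbs_step_def)
      then show ?thesis using P_corner P_other[OF vs] geQ by force
    qed
    have emp: "P u \<noteq> pos delayed v" if "u \<in> {1..n}" "v < u" for u
    proof
      assume e: "P u = pos delayed v"
      then have "pos start u = pos (advance start) v" using far[of u] geQ Qv by simp
      then show False using step v that by (auto simp: bbs_step_def)
    qed
    have fill: "\<exists>u\<in>{1..n}. u < v \<and> pos delayed u = p \<or> v < u \<and> P u = p"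
      if p: "P v < p" "p < pos delayed v" for p
    proof (cases "Suc (Suc q) < p")
      case True
      then have "pos start v < p" using other far[of v] p(1) corner_start by auto
      then obtain u where u: "u \<in> {1..n}" "u < v \<and> pos (advance start) u = p \<or> v < u \<and> pos start u = p"
        using step v p(2) Qv unfolding bbs_step_def by metis
      \<comment> \<open>The witness transfers: old positions beyond box \<open>q + 2\<close> agree
        by \<open>far\<close>, and the only changed target is that of \<open>s\<close>, which the
        undisturbed step puts in box \<open>q + 1\<close>.\<close>
      have "u < v \<and> pos delayed u = p \<or> v < u \<and> P u = p"
        using u pos_delayed[OF u(1)] pos_advance_s True far[of u] by auto
      then show ?thesis using u(1) by blast
    next
      case False
      then have "v = x \<or> v = z" using other far[of v] p by auto
      \<comment> \<open>If \<open>s < z\<close>, ball \<open>z\<close> passes box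
        \<open>q + 2\<close>, where \<open>s\<close> has already arrived. If \<open>z < s\<close>,
        ball \<open>x\<close> passes \<open>s\<close> and \<open>z\<close>, which are larger and
        have not moved.\<close>
      then have "v = z \<and> s < z \<and> p = Suc (Suc q) \<or>
          v = x \<and> P s = Suc q \<and> P z = Suc (Suc q) \<and> (p = Suc q \<or> p = Suc (Suc q))"
        using P_corner p False by auto
      then show ?thesis
        using corner_balls corner_less pos_delayed[OF corner_balls(1)] by metis
    qed
    show ?thesis using Pv emp fill by blast
  qed
qed

lemma has_steady_state_time_corner:
  assumes w: "length w = n" "has_positions n (initial_config w) P"
    and P: "s < z \<and> P = (pos start)(z := Suc q, x := Suc (Suc q)) \<or>
      z < s \<and> P = (pos start)(x := q, s := Suc q)"
    and run: "increasing_run (initial_config w) q [u, v]"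
    and torn: "pos delayed v \<noteq> Suc (pos delayed u)"
  shows "has_steady_state_time w 1"
proof -
  have move: "has_positions n (bbs_move n (initial_config w)) (pos delayed)"
    using w(2) bbs_step_corner[OF P] by (rule has_positions_bbs_move)
  have "\<not> steady_state n (initial_config w)"
    using torn_run_not_steady[OF run move torn] .
  moreover have "steady_state n (bbs_move n (initial_config w))"
    using steady_state_separated[OF separated_delayed move] .
  ultimately show ?thesis by (simp add: has_steady_state_time_def bbs_state_def w(1))
qed

text \<open>Ball \<open>s\<close> lands in box \<open>q + 2\<close>, while \<open>x\<close> lands in
  box \<open>q + 3\<close> or later and \<open>z\<close> right after \<open>x\<close>.\<close>

lemma torn_corner: "pos delayed z \<noteq> Suc (pos delayed s)" "pos delayed s \<noteq> Suc (pos delayed x)"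
  unfolding s_def x_def z_def
  using pos_cell[OF corner_cells(1,2)] pos_cell[OF corner corner_cells(3)]
    pos_cell[OF corner corner_cells(4)] row_nonempty[OF corner] single double
  by (simp_all add: delayed_def advance_def start_single)

lemma length_rows: "length (concat L) = n"
  using distinct_card[OF rows_distinct] rows_balls by simp

lemma config_before_corner:
  assumes "q = Suc k" "initial_config (concat L) k = Some t"
  shows "s < t"
proof -
  have "initial_config (concat L) (start k + 0) = Some (L ! k ! 0)"
    by (rule config_cell[OF has_positions_start]) (use assms corner single'[of k] in auto)
  then show ?thesis using assms(1) assms(2) above_corner[of k] by (simp add: start_single)
qed

lemma swap_K1:
  assumes L: "concat L = p @ [s, x, z] @ t" and q: "length p = q" and sz: "s < z"
  shows "has_steady_state_time (p @ [s, z, x] @ t) 1"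
proof (rule has_steady_state_time_corner)
  let ?w = "p @ [s, z, x] @ t"
  have c: "initial_config ?w = (initial_config (concat L))(Suc q := Some z, Suc (Suc q) := Some x)"
    using initial_config_swap[of "p @ [s]" z x t] q by (simp add: L)
  show "length ?w = n" using length_rows by (simp add: L)
  show "has_positions n (initial_config ?w) ((pos start)(z := Suc q, x := Suc (Suc q)))"
    unfolding c using has_positions_start corner_balls(2,3) corner_start(2,3)
    by (rule has_positions_swap) simp
  show "increasing_run (initial_config ?w) q [s, z]"
  proof (rule increasing_run_pair)
    show "initial_config ?w q = Some s" using q by (auto simp: initial_config_def nth_append)
    show "s < t'" if "q = Suc k" "initial_config ?w k = Some t'" for k t'
      using config_before_corner[OF that(1), of t'] that(2)[unfolded c] that(1) by simp
  qed (use c sz corner_less in auto)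
qed (use sz torn_corner in auto)

lemma swap_K2:
  assumes L: "concat L = p @ [s, x, z] @ t" and q: "length p = q" and sz: "z < s"
  shows "has_steady_state_time (p @ [x, s, z] @ t) 1"
proof (rule has_steady_state_time_corner)
  let ?w = "p @ [x, s, z] @ t"
  have c: "initial_config ?w = (initial_config (concat L))(q := Some x, Suc q := Some s)"
    using initial_config_swap[of p x s "z # t"] q by (simp add: L)
  show "length ?w = n" using length_rows by (simp add: L)
  show "has_positions n (initial_config ?w) ((pos start)(x := q, s := Suc q))"
    unfolding c using has_positions_start corner_balls(1,2) corner_start(1,2)
    by (rule has_positions_swap) simp
  show "increasing_run (initial_config ?w) q [x, s]"
  proof (rule increasing_run_pair)
    show "t' < s" if "initial_config ?w (Suc (Suc q)) = Some t'" for t'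
      using that q sz by (auto simp: initial_config_def nth_append split: if_splits)
    show "x < t'" if "q = Suc k" "initial_config ?w k = Some t'" for k t'
      using config_before_corner[OF that(1), of t'] that(2)[unfolded c] that(1) corner_less by simp
  qed (use c corner_less in auto)
qed (use sz torn_corner in auto)

end

section \<open>Locating Knuth moves in the reading word\<close>

context reading_rows
begin

text \<open>The descent \<open>y x\<close> is a row boundary and the ascent \<open>x z\<close>
  begins the next row. This is the corner once the row ending in \<open>y\<close> is known to have
  one box.\<close>

lemma K1_from_descent:
  assumes L: "concat L = p @ [y, x, z] @ t" and xyz: "x < y" "y < z"
  shows "has_steady_state_time (p @ [y, z, x] @ t) 1"
proof -
  have nth: "concat L ! length p = y" "concat L ! Suc (length p) = x" "concat L ! Suc (Suc (length p)) = z"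
    by (simp_all add: L nth_append)
  have len: "Suc (Suc (length p)) < length (concat L)" by (simp add: L)
  obtain q where q: "Suc q < length L" "Suc (length p) = start (Suc q)"
    "y = L ! q ! (length (L ! q) - 1)" "x = L ! Suc q ! 0"
    using descentE[of "length p"] len nth xyz by (metis Suc_lessD)
  obtain j i where j: "j < length L" "Suc i < length (L ! j)" "Suc (length p) = start j + i"
    using ascentE[of "Suc (length p)"] len nth xyz by (metis order_less_trans)
  have "0 < length (L ! Suc q)" using q row_nonempty by simp
  then have ji: "j = Suc q" "i = 0"
    using separated_cell_eqD[OF separated_start j(1) _ q(1), of i 0] j q by auto
  then have z: "z = L ! Suc q ! 1" using nth_start[OF j(1,2)] j nth(3) by simp
  \<comment> \<open>A second box of row \<open>q\<close> would hold more than \<open>z\<close>, the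
    entry above it, and at most the last entry \<open>y\<close>, against \<open>y < z\<close>. The
    rule \<open>remdups_adj.cases\<close> splits off lists with fewer than two entries.\<close>
  have single: "length (L ! q) = 1"
  proof (rule ccontr)
    assume "length (L ! q) \<noteq> 1"
    then have l: "2 \<le> length (L ! q)" using row_nonempty[of q] q by (cases "L ! q" rule: remdups_adj.cases) auto
    then have "z < L ! q ! 1" unfolding z using q by (intro column) auto
    also have "\<dots> \<le> y" unfolding q(3) using l q by (intro row_le) auto
    finally show False using xyz by simp
  qed
  interpret reading_corner n L q
    by unfold_locales (use q single j ji in auto)
  have "length p = q" using q(2) by (simp add: start_single)
  then show ?thesis
    using swap_K1[of p t] L z q(3,4) single xyz by (simp add: s_def x_def z_def)
qed

text \<open>The letters \<open>z x y\<close> sit like \<open>y x z\<close> in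
  \<open>K1_from_descent\<close>, but here the columns allow a longer row \<open>q\<close>; it is
  properness of the move that excludes it.\<close>

lemma K2_from_descent:
  assumes L: "concat L = p @ [z, x, y] @ t" and xyz: "x < y" "y < z"
    and proper: "\<not> KB_move (p @ [z, x, y] @ t) (p @ [x, z, y] @ t)"
  shows "has_steady_state_time (p @ [x, z, y] @ t) 1"
proof -
  have nth: "concat L ! length p = z" "concat L ! Suc (length p) = x" "concat L ! Suc (Suc (length p)) = y"
    by (simp_all add: L nth_append)
  have len: "Suc (Suc (length p)) < length (concat L)" by (simp add: L)
  obtain q where q: "Suc q < length L" "Suc (length p) = start (Suc q)"
    "z = L ! q ! (length (L ! q) - 1)" "x = L ! Suc q ! 0"
    using descentE[of "length p"] len nth xyz by (metis Suc_lessD order_less_trans)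
  obtain j i where j: "j < length L" "Suc i < length (L ! j)" "Suc (length p) = start j + i"
    using ascentE[of "Suc (length p)"] len nth xyz by metis
  have "0 < length (L ! Suc q)" using q row_nonempty by simp
  then have ji: "j = Suc q" "i = 0"
    using separated_cell_eqD[OF separated_start j(1) _ q(1), of i 0] j q by auto
  then have y: "y = L ! Suc q ! 1" using nth_start[OF j(1,2)] j nth(3) by simp
  have single: "length (L ! q) = 1"
  proof (rule ccontr)
    assume "length (L ! q) \<noteq> 1"
    then obtain d where d: "length (L ! q) = Suc (Suc d)"
      using row_nonempty[of q] q by (cases "L ! q" rule: remdups_adj.cases) auto
    then have p: "length p = Suc (start q + d)" using q by (simp add: start_Suc)
    \<comment> \<open>\<open>y1\<close> is the next-to-last entry of row \<open>q\<close>, the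
      letter just before \<open>z\<close>. It lies between \<open>x\<close> and \<open>z\<close> and
      is the left witness of a \<open>K\<^sub>B\<close> move whose right witness is
      \<open>y\<close>.\<close>
    define y1 where "y1 = L ! q ! d"
    have "last p = concat L ! (start q + d)" using p last_conv_nth[of p] by (cases "p = []") (auto simp: L nth_append)
    then have "last p = y1" using nth_start[of q d] q d by (simp add: y1_def)
    then obtain p' where p': "p = p' @ [y1]" using p by (metis append_butlast_last_id length_0_conv nat.distinct(1))
    have "x < L ! q ! 0" unfolding q(4) using q d by (intro column) auto
    also have "\<dots> \<le> y1" unfolding y1_def using q d by (intro row_le) auto
    finally have "x < y1" .
    moreover have "y1 < z" unfolding y1_def q(3) using q d by (intro row_less) auto
    ultimately have "KB_move (p @ [z, x, y] @ t) (p @ [x, z, y] @ t)"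
      unfolding KB_move_def p'
      by (intro exI[of _ p'] exI[of _ t] exI[of _ x] exI[of _ y1] exI[of _ y] exI[of _ z])
         (use xyz in simp)
    with proper show False ..
  qed
  interpret reading_corner n L q
    by unfold_locales (use q single j ji in auto)
  have "length p = q" using q(2) by (simp add: start_single)
  then show ?thesis
    using swap_K2[of p t] L y q(3,4) single xyz by (simp add: s_def x_def z_def)
qed

text \<open>The row that ends in \<open>y z\<close> has at least two boxes, so the row above it has
  a second letter, which makes the move a \<open>K\<^sub>B\<close> move.\<close>

lemma K1_from_ascent_not_proper:
  assumes L: "concat L = p @ [y, z, x] @ t" and xyz: "x < y" "y < z"
  shows "KB_move (p @ [y, z, x] @ t) (p @ [y, x, z] @ t)"
proof -
  have nth: "concat L ! length p = y" "concat L ! Suc (length p) = z" "concat L ! Suc (Suc (length p)) = x"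
    by (simp_all add: L nth_append)
  have len: "Suc (Suc (length p)) < length (concat L)" by (simp add: L)
  obtain q where q: "Suc q < length L" "Suc (Suc (length p)) = start (Suc q)"
    "z = L ! q ! (length (L ! q) - 1)" "x = L ! Suc q ! 0"
    using descentE[of "Suc (length p)"] len nth xyz by (metis order_less_trans)
  obtain j i where j: "j < length L" "Suc i < length (L ! j)" "length p = start j + i"
    using ascentE[of "length p"] len nth xyz by (metis Suc_lessD)
  have lq: "0 < length (L ! q)" using row_nonempty[of q] q by simp
  have eq: "start q + (length (L ! q) - 1) = start j + Suc i"
    using q(2) j(3) lq start_Suc[OF Suc_lessD[OF q(1)]] by linarith
  have "q = j \<and> length (L ! q) - 1 = Suc i"
    using separated_cell_eqD[OF separated_start Suc_lessD[OF q(1)] diff_less[OF zero_less_one lq] j(1,2) eq] .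
  then have "length (L ! q) - 1 = Suc i" ..
  then have l: "2 \<le> length (L ! q)" by linarith
  then have l': "length (L ! q) \<le> length (L ! Suc q)" using q by (intro row_length_mono)
  define y2 where "y2 = L ! Suc q ! 1"
  have at: "concat L ! Suc (Suc (Suc (length p))) = y2"
    "Suc (Suc (Suc (length p))) < length (concat L)"
    using nth_start[OF q(1), of 1] start_less_length[OF q(1), of 1] l l' q(2) by (simp_all add: y2_def)
  then obtain t' where t: "t = y2 # t'" by (cases t) (auto simp: L nth_append)
  have "x < y2" unfolding y2_def q(4) using q l l' by (intro row_less) auto
  moreover have "y2 < L ! q ! 1" unfolding y2_def using q l by (intro column) auto
  moreover have "L ! q ! 1 \<le> z" unfolding q(3) using q l by (intro row_le) auto
  ultimately show ?thesis
    unfolding KB_move_def t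
    by (intro exI[of _ p] exI[of _ t'] exI[of _ x] exI[of _ y] exI[of _ y2] exI[of _ z])
       (use xyz in simp)
qed

text \<open>The descent \<open>z y\<close> is a row boundary, so by the column condition
  \<open>y\<close> is smaller than every entry of the row ending in \<open>z\<close>. That row
  contains \<open>x\<close>, against \<open>x < y\<close>.\<close>

lemma no_K2_from_ascent:
  assumes L: "concat L = p @ [x, z, y] @ t" and xyz: "x < y" "y < z"
  shows False
proof -
  have nth: "concat L ! length p = x" "concat L ! Suc (length p) = z" "concat L ! Suc (Suc (length p)) = y"
    by (simp_all add: L nth_append)
  have len: "Suc (Suc (length p)) < length (concat L)" by (simp add: L)
  obtain q where q: "Suc q < length L" "Suc (Suc (length p)) = start (Suc q)" "y = L ! Suc q ! 0"
    using descentE[of "Suc (length p)"] len nth xyz by metis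
  obtain j i where j: "j < length L" "Suc i < length (L ! j)" "length p = start j + i"
    using ascentE[of "length p"] len nth xyz by (metis Suc_lessD order_less_trans)
  have lq: "0 < length (L ! q)" using row_nonempty[of q] q by simp
  have eq: "start q + (length (L ! q) - 1) = start j + Suc i"
    using q(2) j(3) lq start_Suc[OF Suc_lessD[OF q(1)]] by linarith
  have "q = j"
    using separated_cell_eqD[OF separated_start Suc_lessD[OF q(1)] diff_less[OF zero_less_one lq] j(1,2) eq]
    by blast
  then have "x = L ! q ! i" using nth_start[of j i] j nth(1) by simp
  moreover have "L ! q ! 0 \<le> L ! q ! i" using j \<open>q = j\<close> by (intro row_le) auto
  moreover have "y < L ! q ! 0" unfolding q(3) using q lq by (intro column) auto
  ultimately show False using xyz by simp
qed

theorem proper_neighbour_steady_state_time: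
  assumes "proper_K1_move (concat L) w \<or> proper_K2_move (concat L) w"
  shows "has_steady_state_time w 1"
proof -
  have nKB: "\<not> KB_move (concat L) w"
    using assms by (auto simp: proper_K1_move_def proper_K2_move_def)
  consider (K1) "K1_move (concat L) w" | (K2) "K2_move (concat L) w"
    using assms by (auto simp: proper_K1_move_def proper_K2_move_def)
  then show ?thesis
  proof cases
    case K1
    then obtain p t x y z where xyz: "x < y" "y < z"
      and "concat L = p @ [y, x, z] @ t \<and> w = p @ [y, z, x] @ t \<or>
        concat L = p @ [y, z, x] @ t \<and> w = p @ [y, x, z] @ t"
      unfolding K1_move_def by blast
    then show ?thesis
      using K1_from_descent K1_from_ascent_not_proper nKB by metis
  next
    case K2
    then obtain p t x y z where xyz: "x < y" "y < z"
      and "concat L = p @ [x, z, y] @ t \<and> w = p @ [z, x, y] @ t \<or>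
        concat L = p @ [z, x, y] @ t \<and> w = p @ [x, z, y] @ t"
      unfolding K2_move_def by blast
    then show ?thesis
      using K2_from_descent no_K2_from_ascent nKB by metis
  qed
qed

end

section \<open>From a standard tableau to its rows in reading order\<close>

lemma standard_tableau_reading_rows:
  assumes T: "standard_tableau n T"
  shows "reading_rows n (rev T)"
proof
  \<comment> \<open>\<open>rev_nth\<close> sends index \<open>j\<close> to
    \<open>length T - Suc j\<close>, so neighbouring rows of \<open>rev T\<close> are neighbours in
    \<open>T\<close> in the opposite order.\<close>
  have rev_Suc: "length T - Suc j = Suc (length T - Suc (Suc j))" if "Suc j < length T" for j
    using that by simp
  have mset: "mset (concat (rev T)) = mset (concat T)" by (simp add: mset_concat flip: rev_map)
  have perm: "set (concat T) = {1..n}" "distinct (concat T)"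
    using T by (auto simp: standard_tableau_def permutations_of_set_def)
  show "distinct (concat (rev T))" using mset_eq_imp_distinct_iff[OF mset] perm by blast
  show "set (concat (rev T)) = {1..n}" using perm by simp
  show "rev T ! j \<noteq> []" "sorted_wrt (<) (rev T ! j)" if "j < length (rev T)" for j
    using that T nth_mem[OF that] unfolding standard_tableau_def by auto
  fix j assume j: "Suc j < length (rev T)"
  have "\<forall>i k. i < k \<and> k < length T \<longrightarrow> length (T ! i) \<ge> length (T ! k)"
    using T unfolding standard_tableau_def by (auto simp: sorted_wrt_iff_nth_less)
  then show "length (rev T ! j) \<le> length (rev T ! Suc j)"
    using j rev_Suc[of j] by (simp add: rev_nth)
  show "rev T ! Suc j ! i < rev T ! j ! i" if "i < length (rev T ! j)" for i
    using T j that rev_Suc[of j] unfolding standard_tableau_def by (simp add: rev_nth)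
qed

theorem theorem7p4:
  fixes n :: nat and T :: "nat list list" and r w :: "nat list"
  assumes "standard_tableau n T"
    and "r = row_reading_word T"
    and "w \<in> permutations_of_set {1..n}"
    and "proper_K1_move r w \<or> proper_K2_move r w"
  shows "has_steady_state_time w 1"
proof -
  interpret reading_rows n "rev T" using assms(1) by (rule standard_tableau_reading_rows)
  show ?thesis
    using assms(4) unfolding assms(2) row_reading_word_def by (rule proper_neighbour_steady_state_time)
qed

end
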